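(* The number $p_n$ of inequivalent integer polygons with perimeter $n$ satisfies $p_n\sim \frac{2^{n-1}}{n}$ as $n\to\infty$.
   Context: An integer polygon is a polygon (with any number $m\geq3$ of sides) whose side lengths are all positive integers; its perimeter is the sum of its side lengths. Reading the side lengths of an $m$-gon starting from any side, clockwise or anticlockwise, gives an $m$-tuple; two polygons are equivalent if they have the same number of sides and the $m$-tuple of one can be obtained from that of the other by cyclically re-ordering and/or reversing the entries. (Side-length tuples of integer polygons of perimeter $n$ are exactly tuples of length $m\geq3$ of positive integers summing to $n$ with every entry less than $n/2$.) $f\sim g$ means $f/g\to1$. *)

theory Defs
  imports "HOL-Analysis.Analysis" "HOL-Library.Landau_Symbols"
begin

text \<open>A polygon in the Euclidean plane is represented by the list of its vertices, in order;
  vertex indices are read cyclically.\<close>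

definition vertex :: "complex list \<Rightarrow> nat \<Rightarrow> complex" where
  "vertex P i = P ! (i mod length P)"

definition side :: "complex list \<Rightarrow> nat \<Rightarrow> complex set" where
  "side P i = closed_segment (vertex P i) (vertex P (Suc i))"

text \<open>Simple closed polygons with at least three sides: distinct sides meet only in common
  endpoints, and no vertex is flat (so that the number of sides is unambiguous).\<close>

definition polygon :: "complex list \<Rightarrow> bool" where
  "polygon P \<longleftrightarrow> 3 \<le> length P \<and> distinct P \<and>
     (\<forall>i<length P. \<forall>j<length P. i \<noteq> j \<longrightarrow>
        side P i \<inter> side P j =
          {vertex P i, vertex P (Suc i)} \<inter> {vertex P j, vertex P (Suc j)}) \<and>
     (\<forall>i<length P. \<not> collinear {vertex P i, vertex P (Suc i), vertex P (Suc (Suc i))})"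

definition side_lengths :: "complex list \<Rightarrow> real list" where
  "side_lengths P = map (\<lambda>i. dist (vertex P i) (vertex P (Suc i))) [0..<length P]"

definition perimeter :: "complex list \<Rightarrow> real" where
  "perimeter P = sum_list (side_lengths P)"

definition integer_polygon :: "complex list \<Rightarrow> bool" where
  "integer_polygon P \<longleftrightarrow> polygon P \<and> (\<forall>l\<in>set (side_lengths P). l \<in> \<int> \<and> 0 < l)"

definition polygon_equivalent :: "complex list \<Rightarrow> complex list \<Rightarrow> bool" where
  "polygon_equivalent P Q \<longleftrightarrow> length P = length Q \<and>
     (\<exists>k. side_lengths Q = rotate k (side_lengths P) \<or>
          side_lengths Q = rotate k (rev (side_lengths P)))"

definition integer_polygons :: "nat \<Rightarrow> complex list set" where
  "integer_polygons n = {P. integer_polygon P \<and> perimeter P = real n}"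

definition num_integer_polygons :: "nat \<Rightarrow> nat" where
  "num_integer_polygons n =
     card (integer_polygons n //
       {(P, Q). P \<in> integer_polygons n \<and> Q \<in> integer_polygons n \<and> polygon_equivalent P Q})"

text \<open>The side-length tuples realised by integer polygons of perimeter n are those described in
  theorem \<open>integer_polygon_side_lengths\<close> below; for the existence part, a polygon with prescribed
  side lengths is inscribed in a circle whose radius is found by the intermediate value theorem.\<close>

lemma ex_angles:
  fixes l :: "nat \<Rightarrow> real"
  assumes "m \<ge> 3" and pos: "\<And>i. i < m \<Longrightarrow> 0 < l i"
    and lt: "\<And>i. i < m \<Longrightarrow> 2 * l i < (\<Sum>i<m. l i)"
  obtains s \<psi> where "s > 0" "\<And>i. i < m \<Longrightarrow> 0 < \<psi> i \<and> \<psi> i < pi \<and> sin (\<psi> i) = l i * s"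
    "(\<Sum>i<m. \<psi> i) = pi"
proof -
  have "\<exists>k\<in>{..<m}. \<forall>i\<in>{..<m}. l i \<le> l k"
  proof -
    have "Max (l ` {..<m}) \<in> l ` {..<m}" using assms(1) by (intro Max_in) (auto simp: lessThan_empty_iff)
    then obtain k where "k < m" "Max (l ` {..<m}) = l k" by blast
    moreover have "l i \<le> Max (l ` {..<m})" if "i < m" for i using that by (intro Max_ge) auto
    ultimately show ?thesis by (intro bexI[of _ k]) auto
  qed
  then obtain k where k: "k < m" and mx: "\<And>i. i < m \<Longrightarrow> l i \<le> l k" by auto
  define a where "a = l k"
  have a: "a > 0" using k pos a_def by auto
  have ls: "0 \<le> l i * s \<and> l i * s \<le> 1" if "i < m" "0 \<le> s" "s \<le> 1 / a" for i s
  proof -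
    have "l i * s \<le> a * (1 / a)" using that mx[of i] pos[of i] a by (intro mult_mono) (auto simp: a_def)
    thus ?thesis using that pos[of i] a by simp
  qed
  have asn: "0 < arcsin (l i * s) \<and> arcsin (l i * s) \<le> pi / 2 \<and> sin (arcsin (l i * s)) = l i * s"
    if "i < m" "0 < s" "s \<le> 1 / a" for i s
  proof -
    have "0 < l i * s" "l i * s \<le> 1" using ls[of i s] that pos[of i] by auto
    thus ?thesis using arcsin_less_arcsin[of 0 "l i * s"] arcsin_bounded[of "l i * s"] by auto
  qed
  have cont: "continuous_on {0..1/a} (\<lambda>s. arcsin (l i * s))" if "i < m" for i
    by (intro continuous_intros ballI) (use ls[OF that] in \<open>force+\<close>)
  have split: "(\<Sum>i<m. f i) = f k + (\<Sum>i\<in>{..<m}-{k}. f i)" for f :: "nat \<Rightarrow> real"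
    using k by (subst sum.remove[of _ k]) auto
  have half: "arcsin (l k * (1 / a)) = pi / 2" using a by (simp add: a_def)
  show ?thesis
  proof (cases "(\<Sum>i\<in>{..<m}-{k}. arcsin (l i * (1/a))) \<ge> pi / 2")
    case True
    have c: "continuous_on {0..1/a} (\<lambda>s. \<Sum>i<m. arcsin (l i * s))"
      by (intro continuous_on_sum cont) auto
    have "\<exists>s\<ge>0. s \<le> 1 / a \<and> (\<Sum>i<m. arcsin (l i * s)) = pi"
      by (rule IVT') (use a True half c in \<open>auto simp: split\<close>)
    then obtain s where s: "s \<ge> 0" "s \<le> 1 / a" "(\<Sum>i<m. arcsin (l i * s)) = pi" by auto
    have "s \<noteq> 0" using s(3) by (intro notI) simp
    hence "s > 0" using s by simp
    show ?thesis
      by (rule that[of s "\<lambda>i. arcsin (l i * s)"]) (use \<open>s > 0\<close> s asn[of _ s] pi_gt_zero in \<open>force+\<close>)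
  next
    case False
    define H where "H = (\<lambda>s. (\<Sum>i\<in>{..<m}-{k}. arcsin (l i * s)) - arcsin (a * s))"
    have "(H has_real_derivative ((\<Sum>i\<in>{..<m}-{k}. l i) - a)) (at 0)"
    proof -
      have *: "((\<lambda>s. arcsin (c * s)) has_real_derivative c) (at 0)" for c :: real
        by (auto intro!: derivative_eq_intros)
      show ?thesis unfolding H_def by (intro DERIV_diff DERIV_sum *)
    qed
    moreover have "(\<Sum>i\<in>{..<m}-{k}. l i) - a > 0" using lt[OF k] split[of l] a_def by simp
    ultimately obtain d where d: "d > 0" "\<And>h. 0 < h \<Longrightarrow> h < d \<Longrightarrow> H 0 < H (0 + h)"
      using DERIV_pos_inc_right by blast
    define s0 where "s0 = min (d / 2) (1 / a)"
    have s0: "s0 > 0" "s0 < d" "s0 \<le> 1 / a" using d a by (auto simp: s0_def)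
    have H0: "H s0 > 0" using d(2)[OF s0(1,2)] by (simp add: H_def)
    have H1: "H (1/a) < 0" using False half by (simp add: H_def a_def)
    have c: "continuous_on {s0..1/a} H"
    proof (rule continuous_on_subset)
      show "continuous_on {0..1/a} H"
        unfolding H_def using cont[OF k] by (intro continuous_on_diff continuous_on_sum cont) (auto simp: a_def)
    qed (use s0 in auto)
    have "\<exists>s\<ge>s0. s \<le> 1 / a \<and> H s = 0"
      by (rule IVT2') (use H0 H1 s0 c in auto)
    then obtain s where s: "s \<ge> s0" "s \<le> 1 / a" "H s = 0" by auto
    have "s > 0" using s s0 by simp
    define \<psi> where "\<psi> = (\<lambda>i. if i = k then pi - arcsin (l k * s) else arcsin (l i * s))"
    have 1: "0 < \<psi> i \<and> \<psi> i < pi \<and> sin (\<psi> i) = l i * s" if "i < m" for i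
      using asn[OF that \<open>s>0\<close> s(2)] pi_gt_zero by (auto simp: \<psi>_def simp del: pi_gt_zero)
    have "(\<Sum>i\<in>{..<m}-{k}. \<psi> i) = (\<Sum>i\<in>{..<m}-{k}. arcsin (l i * s))"
      by (intro sum.cong) (auto simp: \<psi>_def)
    hence 2: "(\<Sum>i<m. \<psi> i) = pi"
      using s(3) by (simp add: split H_def a_def) (simp add: \<psi>_def)
    show ?thesis by (rule that[OF \<open>s > 0\<close> 1 2])
  qed
qed

lemma cos_less_cos_outside:
  fixes x y :: real
  assumes "0 < y" "y < x" "x < 2 * pi - y" "y < pi"
  shows "cos x < cos y"
proof (cases "x \<le> pi")
  case True
  thus ?thesis using assms by (intro cos_monotone_0_pi) auto
next
  case False
  have "cos (2 * pi - x) < cos y" using assms False by (intro cos_monotone_0_pi) auto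
  thus ?thesis by (simp add: cos_diff)
qed

lemma ex_polygon_with_side_lengths:
  fixes ls :: "real list"
  assumes m3: "3 \<le> length ls" and pos: "\<And>l. l \<in> set ls \<Longrightarrow> 0 < l"
    and lt: "\<And>l. l \<in> set ls \<Longrightarrow> 2 * l < sum_list ls"
  obtains P where "polygon P" "side_lengths P = ls"
proof -
  define m where "m = length ls"
  have m: "m \<ge> 3" using m3 m_def by simp
  have sl: "sum_list ls = (\<Sum>i<m. ls ! i)"
    by (simp add: sum_list_sum_nth m_def atLeast0LessThan)
  obtain s \<psi> where s: "s > 0"
    and \<psi>: "\<And>i. i < m \<Longrightarrow> 0 < \<psi> i \<and> \<psi> i < pi \<and> sin (\<psi> i) = ls ! i * s"
    and sum: "(\<Sum>i<m. \<psi> i) = pi"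
    by (rule ex_angles[of m "(!) ls"]) (use m pos lt sl in \<open>auto simp: m_def\<close>)
  define \<theta> where "\<theta> = (\<lambda>j. 2 * (\<Sum>i<j. \<psi> i))"
  define R where "R = 1 / (2 * s)"
  have R: "R > 0" using s by (simp add: R_def)
  define v where "v = (\<lambda>j. complex_of_real R * cis (\<theta> j))"
  define P where "P = map v [0..<m]"
  define f where "f = (\<lambda>i z. Re (z * cis (- (\<theta> i + \<psi> i))) - R * cos (\<psi> i))"
  have lenP: "length P = m" by (simp add: P_def)
  have \<theta>m: "\<theta> m = 2 * pi" "\<theta> 0 = 0" using sum by (simp_all add: \<theta>_def)
  have \<theta>Suc: "\<theta> (Suc i) = \<theta> i + 2 * \<psi> i" for i by (simp add: \<theta>_def)
  have \<theta>mono: "\<theta> i < \<theta> j" if "i < j" "j \<le> m" for i j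
    using that
  proof (induction j)
    case (Suc j)
    have "\<theta> j < \<theta> (Suc j)" using \<psi>[of j] Suc.prems by (simp add: \<theta>Suc)
    thus ?case using Suc by (cases "i = j") auto
  qed auto
  have vm: "v m = v 0" by (simp add: v_def \<theta>m)
  have vtx: "vertex P i = v i" if "i \<le> m" for i
    using that m vm by (cases "i = m") (auto simp: vertex_def P_def)
  have fv: "f i (v j) = R * (cos (\<theta> j - \<theta> i - \<psi> i) - cos (\<psi> i))" for i j
  proof -
    have "v j * cis (- (\<theta> i + \<psi> i)) = complex_of_real R * cis (\<theta> j - \<theta> i - \<psi> i)"
      by (simp add: v_def mult.assoc cis_mult algebra_simps del: minus_add_distrib)
    thus ?thesis unfolding f_def by (simp only:) (simp add: right_diff_distrib)
  qed
  have fi: "f i (v i) = 0" "f i (v (Suc i)) = 0" for i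
    by (simp_all add: fv \<theta>Suc)
  have fneg: "f i (v j) < 0" if "i < m" "j < m" "j \<noteq> i" "j \<noteq> Suc i mod m" for i j
  proof -
    have "cos (\<theta> j - \<theta> i - \<psi> i) < cos (\<psi> i)"
    proof (cases "j > i")
      case True
      hence "Suc i < j" using that by (cases "j = Suc i") auto
      have 1: "\<theta> (Suc i) < \<theta> j" "\<theta> j < \<theta> m" "\<theta> 0 \<le> \<theta> i"
        using \<theta>mono[of "Suc i" j] \<theta>mono[of j m] \<theta>mono[of 0 i] \<open>Suc i < j\<close> that
        by (auto simp: le_less)
      show ?thesis by (rule cos_less_cos_outside) (use 1 \<psi>[of i] that \<theta>m in \<open>auto simp: \<theta>Suc\<close>)
    next
      case False
      hence "j < i" using that by simp
      have "\<theta> (Suc i) - \<theta> j < 2 * pi"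
      proof (cases "Suc i = m")
        case True
        hence "j > 0" using that by (intro Nat.gr0I) auto
        thus ?thesis using \<theta>mono[of 0 j] that True \<theta>m by auto
      next
        case False
        thus ?thesis using \<theta>mono[of "Suc i" m] \<theta>mono[of 0 j] that \<theta>m by (cases "j = 0") auto
      qed
      moreover have "\<theta> j < \<theta> i" using \<theta>mono[of j i] \<open>j < i\<close> that by simp
      ultimately have "cos (\<theta> i - \<theta> j + \<psi> i) < cos (\<psi> i)"
        by (intro cos_less_cos_outside) (use \<psi>[of i] that in \<open>auto simp: \<theta>Suc\<close>)
      moreover have "cos (\<theta> j - \<theta> i - \<psi> i) = cos (\<theta> i - \<theta> j + \<psi> i)"
        by (subst cos_minus[symmetric]) (simp add: algebra_simps)
      ultimately show ?thesis by simp
    qed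
    thus ?thesis using R by (simp add: fv mult_less_0_iff)
  qed
  have faff: "f i ((1 - u) *\<^sub>R x + u *\<^sub>R y) = (1 - u) * f i x + u * f i y" for i u x y
    by (simp add: f_def algebra_simps)
  have len: "dist (v i) (v (Suc i)) = ls ! i" if "i < m" for i
  proof -
    have "v (Suc i) - v i = complex_of_real R * cis (\<theta> i + \<psi> i) * (cis (\<psi> i) - cis (- \<psi> i))"
      by (simp add: v_def \<theta>Suc cis_mult algebra_simps)
    also have "cis (\<psi> i) - cis (- \<psi> i) = complex_of_real (2 * sin (\<psi> i)) * \<i>"
      by (simp add: complex_eq_iff)
    finally have "dist (v i) (v (Suc i)) = R * (2 * \<bar>sin (\<psi> i)\<bar>)"
      using R by (simp add: dist_norm norm_minus_commute[of "v i"] norm_mult)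
    also have "\<dots> = ls ! i"
      using \<psi>[OF that] pos[of "ls ! i"] s that by (simp add: R_def m_def)
    finally show ?thesis .
  qed
  have vS: "v (Suc i) = v (Suc i mod m)" if "i < m" for i
    using that vm by (cases "Suc i = m") auto
  have neq: "v i \<noteq> v j" if ij: "i < m" "j < m" "i \<noteq> j" for i j
  proof (cases "j = Suc i mod m")
    case True
    hence "dist (v i) (v j) = ls ! i" using len[of i] vS[of i] that by simp
    thus ?thesis using pos[of "ls ! i"] that by (auto simp: m_def)
  next
    case False
    thus ?thesis using fneg[of i j] fi(1)[of i] that by auto
  qed
  have "side_lengths P = ls"
    by (rule nth_equalityI) (auto simp: side_lengths_def lenP vtx len m_def[symmetric])
  moreover have "polygon P"
    unfolding polygon_def lenP
  proof (intro conjI allI impI)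
    show "3 \<le> m" by fact
    show "distinct P" unfolding P_def distinct_map inj_on_def using neq by (metis atLeastLessThan_iff distinct_upt set_upt)
  next
    fix i j assume ij: "i < m" "j < m" "i \<noteq> j"
    have mm: "Suc i mod m < m" "Suc j mod m < m" using m by auto
    have A: "{v i, v (Suc i)} \<inter> {v j, v (Suc j)} \<subseteq> side P i \<inter> side P j"
      using ij by (auto simp: side_def vtx)
    have B: "z \<in> {v i, v (Suc i)} \<inter> {v j, v (Suc j)}" if z: "z \<in> side P i" "z \<in> side P j" for z
    proof -
      obtain t where t: "z = (1 - t) *\<^sub>R v i + t *\<^sub>R v (Suc i)"
        using z(1) ij by (simp add: side_def vtx in_segment) blast
      obtain u where u: "0 \<le> u" "u \<le> 1" "z = (1 - u) *\<^sub>R v j + u *\<^sub>R v (Suc j)"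
        using z(2) ij by (simp add: side_def vtx in_segment) blast
      have "f i z = 0" by (simp add: t faff fi)
      hence z0: "(1 - u) * f i (v j) + u * f i (v (Suc j)) = 0" by (simp add: u(3) faff)
      have S: "v (Suc i) = v (Suc i mod m)" "v (Suc j) = v (Suc j mod m)" using vS ij by auto
      have notboth: "\<not> (j = Suc i mod m \<and> Suc j mod m = i)"
        using ij m by (auto simp: mod_Suc split: if_splits)
      have SjneqSi: "Suc j mod m \<noteq> Suc i mod m"
        using ij m by (auto simp: mod_Suc split: if_splits)
      have Sjj: "Suc j mod m \<noteq> j" using ij m by (auto simp: mod_Suc split: if_splits)
      show ?thesis
      proof (cases "j = Suc i mod m")
        case True
        hence "f i (v (Suc j)) < 0" using fneg[of i "Suc j mod m"] S mm ij notboth SjneqSi by auto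
        moreover have "f i (v j) = 0" using True fi[of i] S by simp
        ultimately have "u = 0" using z0 by simp
        thus ?thesis using u(3) True S by simp
      next
        case False
        hence neg: "f i (v j) < 0" using fneg ij by simp
        have np: "f i (v (Suc j)) \<le> 0"
          using fneg[of i "Suc j mod m"] S mm ij SjneqSi fi[of i] by (cases "Suc j mod m = i") auto
        have "(1 - u) * f i (v j) \<le> 0" "u * f i (v (Suc j)) \<le> 0"
          using neg np u by (auto simp: mult_le_0_iff)
        hence *: "(1 - u) * f i (v j) = 0" "u * f i (v (Suc j)) = 0" using z0 by linarith+
        hence "u = 1" using neg by simp
        hence "f i (v (Suc j)) = 0" using * by simp
        hence "Suc j mod m = i" using fneg[of i "Suc j mod m"] S mm ij SjneqSi by auto
        thus ?thesis using u(3) \<open>u = 1\<close> S by simp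
      qed
    qed
    show "side P i \<inter> side P j = {vertex P i, vertex P (Suc i)} \<inter> {vertex P j, vertex P (Suc j)}"
      using A B ij by (auto simp: vtx)
  next
    fix i assume i: "i < m"
    define j where "j = Suc (Suc i) mod m"
    have j: "j < m" "j \<noteq> i" "j \<noteq> Suc i mod m"
      using i m by (auto simp: j_def mod_Suc split: if_splits)
    have vj: "vertex P (Suc (Suc i)) = v j"
      using vtx[of j] j by (simp add: vertex_def lenP j_def)
    have "dist (v i) (v (Suc i)) > 0" using len[OF i] pos[of "ls ! i"] i by (auto simp: m_def)
    hence ne: "v i \<noteq> v (Suc i)" by auto
    show "\<not> collinear {vertex P i, vertex P (Suc i), vertex P (Suc (Suc i))}"
    proof
      assume "collinear {vertex P i, vertex P (Suc i), vertex P (Suc (Suc i))}"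
      hence "v j \<in> affine hull {v i, v (Suc i)}"
        using ne i by (simp add: vtx vj collinear_3_affine_hull)
      then obtain a b where "a + b = 1" "v j = a *\<^sub>R v i + b *\<^sub>R v (Suc i)"
        by (auto simp: affine_hull_2)
      hence "v j = (1 - b) *\<^sub>R v i + b *\<^sub>R v (Suc i)" by (simp add: algebra_simps flip: \<open>a + b = 1\<close>)
      hence "f i (v j) = 0" by (simp add: faff fi)
      thus False using fneg[of i j] i j by simp
    qed
  qed
  ultimately show ?thesis using that by blast
qed

lemma polygon_side_less_half_perimeter:
  assumes "polygon P" "l \<in> set (side_lengths P)"
  shows "2 * l < perimeter P"
proof -
  define m where "m = length P"
  define d where "d = (\<lambda>i. dist (vertex P i) (vertex P (Suc i)))"
  have m: "m \<ge> 3" using assms by (simp add: polygon_def m_def)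
  obtain i where i: "i < m" "l = d i"
    using assms by (auto simp: side_lengths_def m_def d_def)
  have per: "vertex P (j + m) = vertex P j" for j by (simp add: vertex_def m_def)
  have dmod: "d (j mod m) = d j" for j
    by (simp add: d_def vertex_def m_def mod_Suc_eq)
  have path: "dist (vertex P j) (vertex P (j + k)) \<le> (\<Sum>t<k. d (j + t))" for j k
  proof (induction k)
    case (Suc k)
    thus ?case using dist_triangle[of "vertex P j" "vertex P (j + Suc k)" "vertex P (j + k)"]
      by (simp add: d_def)
  qed simp
  have "bij_betw (\<lambda>t. (i + t) mod m) {..<m} {..<m}"
  proof (rule bij_betwI[where g = "\<lambda>t. (t + (m - i)) mod m"])
    show "((i + x) mod m + (m - i)) mod m = x" if "x \<in> {..<m}" for x
      using that i by (subst mod_add_left_eq) simp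
    show "(i + (y + (m - i)) mod m) mod m = y" if "y \<in> {..<m}" for y
      using that i by (subst mod_add_right_eq) simp
  qed (use m in auto)
  hence "(\<Sum>t<m. d ((i + t) mod m)) = (\<Sum>t<m. d t)" by (rule sum.reindex_bij_betw)
  moreover have "perimeter P = (\<Sum>t<m. d t)"
    by (simp add: perimeter_def side_lengths_def d_def m_def interv_sum_list_conv_sum_set_nat atLeast0LessThan)
  ultimately have "perimeter P = (\<Sum>t<m. d (i + t))" by (simp add: dmod)
  also have "m = Suc (Suc (m - 2))" using m by simp
  also have "(\<Sum>t<Suc (Suc (m - 2)). d (i + t)) =
      d i + d (Suc i) + (\<Sum>t<m - 2. d (Suc (Suc i) + t))"
    by (simp add: sum.lessThan_Suc_shift del: sum.lessThan_Suc)
  finally have *: "perimeter P = d i + d (Suc i) + (\<Sum>t<m - 2. d (Suc (Suc i) + t))" .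
  define a b c where "a = vertex P i" "b = vertex P (Suc i)" "c = vertex P (Suc (Suc i))"
  have "Suc (Suc i) + (m - 2) = i + m" using m by simp
  hence "dist c a \<le> (\<Sum>t<m - 2. d (Suc (Suc i) + t))"
    using path[of "Suc (Suc i)" "m - 2"] per[of i] by (simp only: a_b_c_def)
  moreover have "\<not> collinear {a, b, c}"
    using assms i by (simp add: polygon_def a_b_c_def m_def)
  hence "dist a b < dist b c + dist c a"
    using dist_triangle[of a b c] collinear_between_cases[of a b c]
    by (auto simp: between dist_commute)
  ultimately show ?thesis using * i by (simp add: d_def a_b_c_def)
qed

theorem integer_polygon_side_lengths:
  "side_lengths ` integer_polygons n =
     map real ` {xs. 3 \<le> length xs \<and> sum_list xs = n \<and> (\<forall>x\<in>set xs. 0 < x \<and> real x < n / 2)}"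
proof (intro equalityI subsetI)
  fix ls assume "ls \<in> side_lengths ` integer_polygons n"
  then obtain P where P: "polygon P" "perimeter P = n" "ls = side_lengths P"
    and int: "\<And>l. l \<in> set ls \<Longrightarrow> l \<in> \<int> \<and> 0 < l"
    by (auto simp: integer_polygons_def integer_polygon_def)
  define xs where "xs = map (\<lambda>l. nat \<lfloor>l\<rfloor>) ls"
  have "map real xs = ls"
    unfolding xs_def map_map by (rule map_idI) (use int in \<open>force simp: Ints_def\<close>)
  moreover from this have "real (sum_list xs) = sum_list ls"
    by (metis sum_list_of_nat)
  hence "sum_list xs = n" using P by (simp add: perimeter_def)
  moreover have "3 \<le> length xs" using P by (simp add: xs_def side_lengths_def polygon_def)
  moreover have "0 < x \<and> real x < n / 2" if "x \<in> set xs" for x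
  proof -
    have "real x \<in> set ls" using that \<open>map real xs = ls\<close> by force
    thus ?thesis using int[of "real x"] polygon_side_less_half_perimeter[OF P(1), of "real x"] P by simp
  qed
  ultimately show "ls \<in> map real ` {xs. 3 \<le> length xs \<and> sum_list xs = n \<and>
      (\<forall>x\<in>set xs. 0 < x \<and> real x < n / 2)}" by force
next
  fix ls assume "ls \<in> map real ` {xs. 3 \<le> length xs \<and> sum_list xs = n \<and>
      (\<forall>x\<in>set xs. 0 < x \<and> real x < n / 2)}"
  then obtain xs where xs: "ls = map real xs" "3 \<le> length xs" "sum_list xs = n"
    "\<forall>x\<in>set xs. 0 < x \<and> real x < n / 2" by auto
  have sum: "sum_list ls = real n" using xs by (simp add: sum_list_of_nat)
  obtain P where "polygon P" "side_lengths P = ls"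
    by (rule ex_polygon_with_side_lengths[of ls]) (use xs sum in auto)
  hence "P \<in> integer_polygons n"
    using sum xs by (auto simp: integer_polygons_def integer_polygon_def perimeter_def)
  thus "ls \<in> side_lengths ` integer_polygons n" using \<open>side_lengths P = ls\<close> by auto
qed

end

theory Submission
  imports Defs "HOL-Real_Asymp.Real_Asymp"
begin

text \<open>The class of a side-length list of length \<open>m\<close> has at most \<open>2m\<close> elements, with equality unless
  the list is fixed by a non-trivial rotation or by a reflection. Hence the number of classes is
  the sum of \<open>1/(2m)\<close> over all compositions of \<open>n\<close>, up to the number of compositions that are
  symmetric or have a part of size at least \<open>n/2\<close>. Since
  \<open>(n-1 choose m-1)/(2m) = (n choose m)/(2n)\<close>, that sum is \<open>(2\<^sup>n - 1)/(2n)\<close>. Every exceptional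
  composition is determined by a composition of a number at most \<open>n/2\<close> and boundedly many numbers
  at most \<open>n\<close>: a periodic list by one period, a list reversed by a rotation because it is a
  concatenation of two palindromes. So the error is at most a polynomial times \<open>2\<^sup>n\<^sup>/\<^sup>2\<close>.\<close>

section \<open>Dihedral classes of lists\<close>

definition dihedral_class :: "'a list \<Rightarrow> 'a list set" where
  "dihedral_class xs = range (\<lambda>k. rotate k xs) \<union> range (\<lambda>k. rotate k (rev xs))"

lemma dihedral_class_iff:
  "ys \<in> dihedral_class xs \<longleftrightarrow> (\<exists>k. ys = rotate k xs \<or> ys = rotate k (rev xs))"
  by (auto simp: dihedral_class_def)

lemma rotate_inverse: "\<exists>k. rotate k (rotate j xs) = xs"
proof (cases "xs = []")
  case False
  define i where "i = j mod length xs"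
  have "i < length xs" using False by (simp add: i_def)
  hence "rotate (length xs - i) (rotate i xs) = xs" by (simp add: rotate_rotate)
  thus ?thesis unfolding i_def by (metis rotate_conv_mod)
qed auto

text \<open>A rotation swaps the two blocks of a cut list. Reversing the swapped list gives the
  reversed blocks in the original order, while \<open>rev xs\<close> has them in the opposite order,
  so the two differ by a rotation.\<close>

lemma rev_rotate: "\<exists>k. rev (rotate j xs) = rotate k (rev xs)"
proof -
  define i where "i = j mod length xs"
  have "rev (rotate j xs) = rev (take i xs) @ rev (drop i xs)"
    by (simp add: rotate_drop_take i_def)
  also have "\<dots> = rotate (length (rev (drop i xs))) (rev (drop i xs) @ rev (take i xs))"
    by (rule rotate_append[symmetric])
  also have "rev (drop i xs) @ rev (take i xs) = rev xs"
    by (simp flip: rev_append)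
  finally show ?thesis by blast
qed

lemma self_in_dihedral_class: "xs \<in> dihedral_class xs"
  using rotate_conv_mod[of 0 xs] unfolding dihedral_class_iff by (intro exI[of _ 0]) simp

lemma dihedral_class_trans:
  assumes "ys \<in> dihedral_class xs" "zs \<in> dihedral_class ys"
  shows "zs \<in> dihedral_class xs"
proof -
  obtain j k where j: "ys = rotate j xs \<or> ys = rotate j (rev xs)"
    and k: "zs = rotate k ys \<or> zs = rotate k (rev ys)"
    using assms by (auto simp: dihedral_class_iff)
  obtain a b where "rev (rotate j xs) = rotate a (rev xs)" "rev (rotate j (rev xs)) = rotate b xs"
    using rev_rotate[of j xs] rev_rotate[of j "rev xs"] by auto
  thus ?thesis using j k by (auto simp: dihedral_class_iff rotate_rotate)
qed

lemma dihedral_class_sym: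
  assumes "ys \<in> dihedral_class xs"
  shows "xs \<in> dihedral_class ys"
proof -
  obtain j where j: "ys = rotate j xs \<or> ys = rotate j (rev xs)"
    using assms by (auto simp: dihedral_class_iff)
  obtain a where a: "rotate a (rotate j xs) = xs" using rotate_inverse by blast
  obtain b where b: "rotate b (rotate j (rev xs)) = rev xs" using rotate_inverse by blast
  obtain c where c: "rev (rotate b (rotate j (rev xs))) = rotate c (rev (rotate j (rev xs)))"
    using rev_rotate by blast
  \<comment> \<open>Undoing the rotation gives \<open>rev xs\<close>; reversing once more gives
    \<open>xs\<close>, and \<open>rev_rotate\<close> exchanges that reversal with the
    rotation.\<close>
  have "xs = rotate c (rev (rotate j (rev xs)))" using b c by simp
  thus ?thesis using j a unfolding dihedral_class_iff by metis
qed

text \<open>Turns equivalence into equality of the values of a function, so that equivalence classes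
  can be counted as an image.\<close>

lemma dihedral_class_eq_iff:
  "dihedral_class xs = dihedral_class ys \<longleftrightarrow> ys \<in> dihedral_class xs"
  using self_in_dihedral_class dihedral_class_trans dihedral_class_sym by blast

text \<open>Serves to pass from lists of real side lengths to lists of natural numbers.\<close>

lemma dihedral_class_map: "dihedral_class (map f xs) = map f ` dihedral_class xs"
  by (auto simp: dihedral_class_def rotate_map rev_map image_Un image_image)

lemma dihedral_class_invariants:
  assumes "ys \<in> dihedral_class xs"
  shows "length ys = length xs" "set ys = set xs" "mset ys = mset xs"
proof -
  have *: "mset (rotate k zs) = mset zs" for k and zs :: "'a list"
    by (simp add: rotate_drop_take flip: mset_append)
       (metis append_take_drop_id mset_append union_commute)
  show "length ys = length xs" "set ys = set xs" "mset ys = mset xs"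
    using assms by (auto simp: dihedral_class_iff *)
qed

text \<open>The class is the orbit under a dihedral group whose \<open>2 * length xs\<close>
  elements are coded by a reflection bit and a rotation amount. Failure of this parametrisation to
  be injective is what detects symmetric lists.\<close>

lemma dihedral_class_conv_image:
  assumes "xs \<noteq> []"
  shows "dihedral_class xs =
    (\<lambda>(b, k). rotate k (if b then rev xs else xs)) ` (UNIV \<times> {..<length xs})"
proof -
  have "range (\<lambda>k. rotate k zs) = (\<lambda>k. rotate k zs) ` {..<length zs}"
    if "zs \<noteq> []" for zs :: "'a list"
    using that rotate_conv_mod[of _ zs] by (auto intro!: image_eqI[of _ _ "_ mod length zs"])
  from this[of xs] this[of "rev xs"]
  have "dihedral_class xs = (\<lambda>k. rotate k xs) ` {..<length xs} \<union> (\<lambda>k. rotate k (rev xs)) ` {..<length xs}"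
    using assms by (simp add: dihedral_class_def)
  also have "\<dots> = (\<lambda>(b, k). rotate k (if b then rev xs else xs)) `
      ({False} \<times> {..<length xs} \<union> {True} \<times> {..<length xs})"
    by (simp add: image_Un image_image Sigma_def UNION_singleton_eq_range)
  also have "{False} \<times> {..<length xs} \<union> {True} \<times> {..<length xs} = UNIV \<times> {..<length xs}"
    by (auto simp: UNIV_bool)
  finally show ?thesis .
qed

lemma finite_dihedral_class: "finite (dihedral_class xs)"
  by (cases "xs = []") (auto simp: dihedral_class_conv_image, simp add: dihedral_class_def)

lemma card_dihedral_class_pos: "card (dihedral_class xs) > 0"
  using finite_dihedral_class[of xs] self_in_dihedral_class[of xs] by (auto simp: card_gt_0_iff)

lemma card_dihedral_class_le:
  assumes "xs \<noteq> []"
  shows "card (dihedral_class xs) \<le> 2 * length xs"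
proof -
  have "card (dihedral_class xs) \<le> card ((UNIV :: bool set) \<times> {..<length xs})"
    unfolding dihedral_class_conv_image[OF assms] by (intro card_image_le) auto
  thus ?thesis by (simp add: card_cartesian_product)
qed

text \<open>A smaller orbit means that two codes give the same list. Equal reflection bits yield a
  non-trivial rotation fixing \<open>xs\<close>; different bits yield a reflection, where
  \<open>d = 0\<close> covers palindromes.\<close>

lemma card_dihedral_class_less_cases:
  assumes "xs \<noteq> []" "card (dihedral_class xs) \<noteq> 2 * length xs"
  obtains (rotation) d where "0 < d" "d < length xs" "rotate d xs = xs"
  | (reflection) d where "d < length xs" "rotate d xs = rev xs"
proof -
  define m where "m = length xs"
  define g where "g = (\<lambda>(b, k). rotate k (if b then rev xs else xs))"
  have "\<not> inj_on g (UNIV \<times> {..<m})"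
    using assms card_image[of g "UNIV \<times> {..<m}"]
    by (auto simp: g_def m_def dihedral_class_conv_image card_cartesian_product)
  then obtain b j c k where eq: "g (b, j) = g (c, k)" "(b, j) \<noteq> (c, k)" "j < m" "k < m"
    by (auto simp: inj_on_def)
  \<comment> \<open>Rotating both sides by \<open>m - k\<close> cancels the rotation by
    \<open>k\<close>. Since \<open>j\<close> and \<open>k\<close> are below \<open>m\<close>, the
    resulting amount vanishes modulo \<open>m\<close> only if they agree.\<close>
  have shift: "\<exists>d<m. rotate d ys = zs \<and> (j \<noteq> k \<longrightarrow> 0 < d)"
    if "rotate j ys = rotate k zs" "j < m" "k < m" "length ys = m" "length zs = m"
    for j k and ys zs :: "'a list"
  proof -
    have "rotate ((m - k + j) mod m) ys = rotate (m - k + j) ys"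
      using that(4) rotate_conv_mod[of "m - k + j" ys] by simp
    also have "\<dots> = rotate (m - k) (rotate j ys)" by (simp only: rotate_rotate)
    also have "\<dots> = rotate (m - k) (rotate k zs)" by (simp only: that)
    also have "\<dots> = zs" using that by (simp add: rotate_rotate)
    finally have "rotate ((m - k + j) mod m) ys = zs" .
    moreover have "(m - k + j) mod m > 0" if neq: "j \<noteq> k"
    proof -
      consider "j < k" | "j > k" using neq by linarith
      thus ?thesis
      proof cases
        case 2
        hence "m - k + j = m + (j - k)" using \<open>j < m\<close> \<open>k < m\<close> by simp
        moreover have "(m + (j - k)) mod m = j - k" using \<open>j < m\<close> by (subst mod_add_self1) simp
        ultimately show ?thesis using 2 by simp
      qed (use \<open>j < m\<close> \<open>k < m\<close> in simp)
    qed
    ultimately show ?thesis using \<open>j < m\<close> by (intro exI[of _ "(m - k + j) mod m"]) auto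
  qed
  have len: "length xs = m" "length (rev xs) = m" by (simp_all add: m_def)
  show ?thesis
  proof (cases "b = c")
    case True
    define ys where "ys = (if b then rev xs else xs)"
    have "rotate j ys = rotate k ys" "j \<noteq> k" "length ys = m"
      using eq True by (auto simp: g_def ys_def m_def)
    then obtain d where d: "0 < d" "d < m" "rotate d ys = ys"
      using shift[of j ys k ys] eq by auto
    show ?thesis
    proof (cases b)
      case False
      thus ?thesis using d rotation by (simp add: ys_def m_def)
    next
      case True
      hence r: "rotate d (rev xs) = rev xs" using d by (simp add: ys_def)
      have "rotate (m - d) xs = xs"
        using r rotate_rev[of d xs] d by (simp add: m_def)
      thus ?thesis using d rotation[of "m - d"] by (simp add: m_def)
    qed
  next
    case False
    hence "rotate j xs = rotate k (rev xs) \<or> rotate k xs = rotate j (rev xs)"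
      using eq by (auto simp: g_def split: if_splits)
    then obtain d where "d < m" "rotate d xs = rev xs"
      using shift[OF _ eq(3,4) len] shift[OF _ eq(4,3) len] by blast
    thus ?thesis using reflection by (simp add: m_def)
  qed
qed

section \<open>Counting equivalence classes\<close>

text \<open>The classes are the fibres of \<open>f\<close>; fibres over distinct values of the image
  are non-empty and disjoint, hence distinct.\<close>

lemma card_quotient_kernel:
  "card (A // {(x, y). x \<in> A \<and> y \<in> A \<and> f x = f y}) = card (f ` A)"
proof -
  let ?R = "{(x, y). x \<in> A \<and> y \<in> A \<and> f x = f y}"
  have "?R `` {x} = A \<inter> f -` {f x}" if "x \<in> A" for x using that by auto
  hence "A // ?R = (\<lambda>z. A \<inter> f -` {z}) ` f ` A"
    by (simp add: quotient_def image_image UNION_singleton_eq_range)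
  moreover have "inj_on (\<lambda>z. A \<inter> f -` {z}) (f ` A)" by (auto simp: inj_on_def)
  ultimately show ?thesis by (simp add: card_image)
qed

text \<open>Grouping the sum by classes, a class \<open>c\<close> lies wholly in \<open>X\<close>
  and supplies \<open>card c\<close> terms equal to \<open>1 / card c\<close>, hence exactly
  1.\<close>

lemma card_dihedral_classes:
  assumes "finite X" and closed: "\<And>xs. xs \<in> X \<Longrightarrow> dihedral_class xs \<subseteq> X"
  shows "real (card (dihedral_class ` X)) = (\<Sum>xs\<in>X. 1 / real (card (dihedral_class xs)))"
proof -
  have "(\<Sum>xs\<in>X. 1 / real (card (dihedral_class xs))) =
      (\<Sum>c\<in>dihedral_class ` X. \<Sum>xs\<in>{x \<in> X. dihedral_class x = c}. 1 / real (card (dihedral_class xs)))"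
    by (rule sum.image_gen[OF assms(1)])
  also have "\<dots> = (\<Sum>c\<in>dihedral_class ` X. 1)"
  proof (rule sum.cong[OF refl])
    fix c assume "c \<in> dihedral_class ` X"
    then obtain xs where xs: "xs \<in> X" "c = dihedral_class xs" by auto
    have "{x \<in> X. dihedral_class x = c} = c"
      using closed[OF xs(1)] xs(2) dihedral_class_eq_iff dihedral_class_sym by blast
    moreover have "(\<Sum>xs\<in>{x \<in> X. dihedral_class x = c}. 1 / real (card (dihedral_class xs))) =
        (\<Sum>xs\<in>{x \<in> X. dihedral_class x = c}. 1 / real (card c))"
      by (rule sum.cong) auto
    ultimately show "(\<Sum>xs\<in>{x \<in> X. dihedral_class x = c}. 1 / real (card (dihedral_class xs))) = 1"
      using card_dihedral_class_pos[of xs] xs by simp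
  qed
  finally show ?thesis by simp
qed

section \<open>Compositions and their weighted sum\<close>

definition compositions :: "nat \<Rightarrow> nat list set" where
  "compositions n = {xs. sum_list xs = n \<and> (\<forall>x\<in>set xs. 0 < x)}"

definition compositions_upto :: "nat \<Rightarrow> nat list set" where
  "compositions_upto n = {xs. sum_list xs \<le> n \<and> (\<forall>x\<in>set xs. 0 < x)}"

text \<open>Induction on \<open>n\<close>: a non-empty list for \<open>Suc n\<close> either starts
  with 1, and its tail is a list for \<open>n\<close>, or lowering its head by 1 leaves a non-empty
  list for \<open>n\<close>.\<close>

lemma compositions_upto_bound: "finite (compositions_upto n) \<and> card (compositions_upto n) \<le> 2 ^ n"
proof (induction n)
  case 0
  have "compositions_upto 0 = {[]}"
  proof -
    have "xs = []" if "sum_list xs = 0" "\<forall>x\<in>set xs. 0 < x" for xs :: "nat list"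
      using that by (cases xs) auto
    thus ?thesis by (auto simp: compositions_upto_def)
  qed
  thus ?case by simp
next
  case (Suc n)
  let ?C = "compositions_upto n"
  let ?g = "\<lambda>xs :: nat list. Suc (hd xs) # tl xs"
  have sub: "compositions_upto (Suc n) \<subseteq> {[]} \<union> Cons 1 ` ?C \<union> ?g ` (?C - {[]})"
  proof
    fix xs assume xs: "xs \<in> compositions_upto (Suc n)"
    show "xs \<in> {[]} \<union> Cons 1 ` ?C \<union> ?g ` (?C - {[]})"
    proof (cases xs)
      case (Cons x ys)
      show ?thesis
      proof (cases "x = 1")
        case True
        thus ?thesis using xs Cons by (auto simp: compositions_upto_def)
      next
        case False
        hence "(x - 1) # ys \<in> ?C - {[]}" "xs = ?g ((x - 1) # ys)"
          using xs Cons by (auto simp: compositions_upto_def)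
        thus ?thesis by blast
      qed
    qed simp
  qed
  have fin: "finite ({[]} \<union> Cons 1 ` ?C \<union> ?g ` (?C - {[]}))" using Suc by auto
  have "card ({[]} \<union> Cons 1 ` ?C \<union> ?g ` (?C - {[]})) \<le> 1 + card ?C + card (?C - {[]})"
  proof -
    have "card (Cons 1 ` ?C) \<le> card ?C" "card (?g ` (?C - {[]})) \<le> card (?C - {[]})"
      using Suc by (auto intro!: card_image_le)
    moreover have "card ({[]} \<union> Cons 1 ` ?C \<union> ?g ` (?C - {[]})) \<le>
        card {[] :: nat list} + card (Cons 1 ` ?C) + card (?g ` (?C - {[]}))"
      by (intro order.trans[OF card_Un_le] add_mono card_Un_le order.refl)
    ultimately show ?thesis by simp
  qed
  \<comment> \<open>Excluding \<open>[]\<close> from the second family offsets the extra empty list,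
    so the bound exactly doubles.\<close>
  moreover have "card (?C - {[]}) = card ?C - 1" "card ?C > 0"
  proof -
    have "[] \<in> ?C" by (simp add: compositions_upto_def)
    thus "card (?C - {[]}) = card ?C - 1" "card ?C > 0" using Suc by (auto simp: card_gt_0_iff)
  qed
  ultimately have "card (compositions_upto (Suc n)) \<le> 1 + card ?C + (card ?C - 1)" "card ?C > 0"
    using card_mono[OF fin sub] by linarith+
  thus ?case using Suc finite_subset[OF sub fin] by simp
qed

lemma finite_compositions: "finite (compositions n)"
  using compositions_upto_bound[of n]
  by (auto simp: compositions_def compositions_upto_def intro: rev_finite_subset)

lemma length_le_sum_list:
  "(\<forall>x\<in>set xs. 0 < x) \<Longrightarrow> length xs \<le> sum_list (xs :: nat list)"
  by (induction xs) (auto simp: Suc_le_eq)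

text \<open>Subtracting 1 from each part leaves \<open>m\<close> natural numbers with sum
  \<open>n - m\<close>, which stars and bars counts.\<close>

lemma card_compositions_length:
  assumes "1 \<le> m" "m \<le> n"
  shows "card {xs \<in> compositions n. length xs = m} = (n - 1) choose (m - 1)"
proof -
  let ?L = "{l :: nat list. length l = m \<and> sum_list l = n - m}"
  have sum: "sum_list (map Suc l) = sum_list l + length l" for l by (induction l) auto
  have "{xs \<in> compositions n. length xs = m} = map Suc ` ?L"
  proof (intro equalityI subsetI)
    fix xs assume xs: "xs \<in> {xs \<in> compositions n. length xs = m}"
    define l where "l = map (\<lambda>x. x - 1) xs"
    have eq: "xs = map Suc l" using xs unfolding l_def map_map
      by (intro map_idI[symmetric]) (auto simp: compositions_def)
    thus "xs \<in> map Suc ` ?L" using xs sum[of l] by (auto simp: compositions_def)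
  qed (use assms sum in \<open>auto simp: compositions_def\<close>)
  hence "card {xs \<in> compositions n. length xs = m} = card ?L"
    by (simp add: card_image inj_on_def)
  also have "\<dots> = (n - m + m - 1) choose (n - m)" by (rule card_length_sum_list)
  also have "\<dots> = (n - 1) choose (m - 1)"
    using assms binomial_symmetric[of "m - 1" "n - 1"] by simp
  finally show ?thesis .
qed

lemma sum_inverse_length_compositions:
  assumes "n \<ge> 1"
  shows "(\<Sum>xs\<in>compositions n. 1 / (2 * real (length xs))) = (2 ^ n - 1) / (2 * real n)"
proof -
  have sub: "length ` compositions n \<subseteq> {1..n}"
    using length_le_sum_list assms by (force simp: compositions_def Suc_le_eq)
  have "(\<Sum>xs\<in>compositions n. 1 / (2 * real (length xs))) =
      (\<Sum>m\<in>{1..n}. \<Sum>xs\<in>{xs \<in> compositions n. length xs = m}. 1 / (2 * real (length xs)))"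
    by (rule sum.group[symmetric, OF finite_compositions _ sub]) simp
  also have "\<dots> = (\<Sum>m\<in>{1..n}. real (n choose m) / (2 * real n))"
  proof (rule sum.cong[OF refl])
    fix m assume m: "m \<in> {1..n}"
    have "(\<Sum>xs\<in>{xs \<in> compositions n. length xs = m}. 1 / (2 * real (length xs))) =
        (\<Sum>xs\<in>{xs \<in> compositions n. length xs = m}. 1 / (2 * real m))"
      by (rule sum.cong) auto
    also have "\<dots> = real ((n - 1) choose (m - 1)) / (2 * real m)"
      using m by (simp add: card_compositions_length)
    also have "\<dots> = real (n choose m) / (2 * real n)"
    proof -
      have "m * (n choose m) = n * ((n - 1) choose (m - 1))"
        using times_binomial_minus1_eq[of m n] m by simp
      hence "real m * real (n choose m) = real n * real ((n - 1) choose (m - 1))"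
        by (metis of_nat_mult)
      thus ?thesis using m by (simp add: field_simps)
    qed
    finally show "(\<Sum>xs\<in>{xs \<in> compositions n. length xs = m}. 1 / (2 * real (length xs))) =
        real (n choose m) / (2 * real n)" .
  qed
  also have "\<dots> = (\<Sum>m\<in>{1..n}. real (n choose m)) / (2 * real n)"
    by (simp add: sum_divide_distrib)
  \<comment> \<open>The row of binomial coefficients lacks its entry at 0, since no composition of a
    positive number is empty; this gives the \<open>- 1\<close>.\<close>
  also have "(\<Sum>m\<in>{1..n}. real (n choose m)) = 2 ^ n - 1"
  proof -
    have "(\<Sum>m\<le>n. n choose m) = 2 ^ n" by (rule choose_row_sum)
    moreover have "{..n} = insert 0 {1..n}" by auto
    ultimately have "1 + (\<Sum>m\<in>{1..n}. n choose m) = 2 ^ n" by simp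
    hence "real (1 + (\<Sum>m\<in>{1..n}. n choose m)) = 2 ^ n" by (metis of_nat_numeral of_nat_power)
    thus ?thesis by simp
  qed
  finally show ?thesis .
qed

section \<open>Exceptional compositions are rare\<close>

text \<open>Lists described by four numbers up to \<open>n\<close> and a composition of a number up to \<open>n/2\<close> are
  negligible among the \<open>2\<^sup>n\<^sup>-\<^sup>1\<close> compositions of \<open>n\<close>.\<close>

definition negligible_bound :: "nat \<Rightarrow> nat" where
  "negligible_bound n = (n + 1) ^ 4 * 2 ^ (n div 2)"

text \<open>It suffices that the decoding \<open>g\<close> reaches all of \<open>S\<close>; codes
  need not be unique. One format of codes serves all three exceptional families.\<close>

lemma card_le_negligible_bound:
  fixes g :: "nat \<Rightarrow> nat \<Rightarrow> nat \<Rightarrow> nat \<Rightarrow> nat list \<Rightarrow> 'a"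
  assumes "\<And>x. x \<in> S \<Longrightarrow>
    \<exists>a\<le>n. \<exists>b\<le>n. \<exists>c\<le>n. \<exists>d\<le>n. \<exists>h\<in>compositions_upto (n div 2). x = g a b c d h"
  shows "card S \<le> negligible_bound n"
proof -
  let ?D = "{..n} \<times> {..n} \<times> {..n} \<times> {..n} \<times> compositions_upto (n div 2)"
  have "S \<subseteq> (\<lambda>(a, b, c, d, h). g a b c d h) ` ?D"
  proof
    fix x assume "x \<in> S"
    from assms[OF this] obtain a b c d h where "(a, b, c, d, h) \<in> ?D" "x = g a b c d h" by auto
    thus "x \<in> (\<lambda>(a, b, c, d, h). g a b c d h) ` ?D"
      by (intro image_eqI[of _ _ "(a, b, c, d, h)"]) auto
  qed
  hence "card S \<le> card ?D" using compositions_upto_bound by (intro surj_card_le) auto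
  also have "\<dots> = (n + 1) ^ 4 * card (compositions_upto (n div 2))"
    by (simp add: card_cartesian_product power4_eq_xxxx mult.assoc del: mult_Suc mult_Suc_right)
  also have "\<dots> \<le> negligible_bound n"
    unfolding negligible_bound_def using compositions_upto_bound by (intro mult_left_mono) auto
  finally show ?thesis .
qed

text \<open>Deleting a part of size at least \<open>n/2\<close> leaves a list of sum at most
  \<open>n/2\<close>; the position and size of the deleted part restore the original.\<close>

lemma card_compositions_big_part:
  "card {xs \<in> compositions n. \<exists>x\<in>set xs. n \<le> 2 * x} \<le> negligible_bound n"
proof (rule card_le_negligible_bound[where g = "\<lambda>i x _ _ h. take i h @ x # drop i h"])
  fix xs assume xs: "xs \<in> {xs \<in> compositions n. \<exists>x\<in>set xs. n \<le> 2 * x}"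
  then obtain x us vs where eq: "xs = us @ x # vs" "n \<le> 2 * x" by (auto dest: split_list)
  have "us @ vs \<in> compositions_upto (n div 2)" "x \<le> n"
    using xs eq by (auto simp: compositions_def compositions_upto_def)
  moreover have "length us \<le> n"
    using xs eq length_le_sum_list[of us] by (auto simp: compositions_def)
  moreover have "xs = take (length us) (us @ vs) @ x # drop (length us) (us @ vs)"
    using eq by simp
  ultimately show "\<exists>a\<le>n. \<exists>b\<le>n. \<exists>c\<le>n. \<exists>d\<le>n. \<exists>h\<in>compositions_upto (n div 2).
      xs = take a h @ b # drop a h" by blast
qed

text \<open>The code consists of a period \<open>d\<close>, the length \<open>m\<close> and the
  first \<open>d\<close> entries. The period need not divide the length, as the last copy may be cut
  short.\<close>

lemma card_compositions_rotation:
  "card {xs \<in> compositions n. \<exists>d. 0 < d \<and> d < length xs \<and> rotate d xs = xs} \<le> negligible_bound n"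
proof (rule card_le_negligible_bound[where g = "\<lambda>d m _ _ h. map (\<lambda>i. h ! (i mod d)) [0..<m]"])
  fix xs assume "xs \<in> {xs \<in> compositions n. \<exists>d. 0 < d \<and> d < length xs \<and> rotate d xs = xs}"
  then obtain e where xs: "xs \<in> compositions n" and e: "0 < e" "e < length xs" "rotate e xs = xs"
    by auto
  define m where "m = length xs"
  \<comment> \<open>If \<open>e\<close> fixes the list, so does \<open>m - e\<close>, and one of
    them is at most \<open>m/2\<close>. Two full periods then fit into the list.\<close>
  have "\<exists>d>0. 2 * d \<le> m \<and> rotate d xs = xs"
  proof (cases "2 * e \<le> m")
    case False
    have "rotate (m - e) xs = rotate (m - e) (rotate e xs)" using e by simp
    also have "\<dots> = xs" unfolding rotate_rotate using e(2) by (simp add: m_def)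
    finally show ?thesis using e False by (intro exI[of _ "m - e"]) (auto simp: m_def)
  qed (use e in auto)
  then obtain d where d: "d > 0" "2 * d \<le> m" "rotate d xs = xs" by auto
  \<comment> \<open>Invariance under rotation by \<open>d\<close> gives
    \<open>xs ! i = xs ! (i - d)\<close> whenever \<open>d \<le> i < m\<close>, with no
    wrap-around.\<close>
  have per: "xs ! i = xs ! (i mod d)" if "i < m" for i
    using that
  proof (induction i rule: less_induct)
    case (less i)
    show ?case
    proof (cases "i < d")
      case False
      have "xs ! i = xs ! ((d + (i - d)) mod m)" using less.prems False by simp
      also have "\<dots> = xs ! (i - d)"
        using nth_rotate[of "i - d" xs d] less.prems d by (simp add: m_def)
      also have "\<dots> = xs ! ((i - d) mod d)" using less d False by simp
      also have "(i - d) mod d = i mod d" using False by (simp add: le_mod_geq)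
      finally show ?thesis .
    qed simp
  qed
  have eq: "xs = map (\<lambda>i. take d xs ! (i mod d)) [0..<m]"
    by (rule nth_equalityI) (use per d in \<open>auto simp: m_def\<close>)
  \<comment> \<open>The first period occurs twice, so twice its sum is at most
    \<open>n\<close>.\<close>
  have "take d xs = take d (drop d xs)"
  proof (rule nth_equalityI)
    fix i assume "i < length (take d xs)"
    thus "take d xs ! i = take d (drop d xs) ! i"
      using per[of "d + i"] d by (simp add: m_def)
  qed (use d in \<open>auto simp: m_def\<close>)
  hence "xs = take d xs @ take d xs @ drop d (drop d xs)"
    by (metis append_take_drop_id)
  hence "sum_list xs = sum_list (take d xs) + (sum_list (take d xs) + sum_list (drop d (drop d xs)))"
    by (metis sum_list.append)
  hence h: "take d xs \<in> compositions_upto (n div 2)"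
    using xs by (auto simp: compositions_def compositions_upto_def dest: in_set_takeD)
  have "m \<le> n" using xs length_le_sum_list[of xs] by (auto simp: compositions_def m_def)
  thus "\<exists>a\<le>n. \<exists>b\<le>n. \<exists>c\<le>n. \<exists>d\<le>n. \<exists>h\<in>compositions_upto (n div 2).
      xs = map (\<lambda>i. h ! (i mod a)) [0..<b]"
    using d h eq by (intro exI[of _ d] exI[of _ m] exI[of _ 0] conjI bexI[of _ "take d xs"]) auto
qed

text \<open>A zero middle part encodes a palindrome of even length, as the parts of a composition are
  positive.\<close>

definition palindrome_of :: "nat list \<Rightarrow> nat \<Rightarrow> nat list" where
  "palindrome_of h c = h @ (if c = 0 then [] else [c]) @ rev h"

lemma palindrome_conv_palindrome_of:
  assumes "rev xs = xs" "\<forall>x\<in>set xs. 0 < x"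
  obtains h c where "xs = palindrome_of h c"
proof -
  define k where "k = length xs div 2"
  have t: "drop (length xs - k) xs = rev (take k xs)"
    using assms(1) rev_take[of k xs] by simp
  show ?thesis
  proof (cases "even (length xs)")
    case True
    hence "length xs - k = k" by (auto simp: k_def)
    hence "xs = palindrome_of (take k xs) 0"
      using t append_take_drop_id[of k xs] by (simp add: palindrome_of_def)
    thus ?thesis by (rule that)
  next
    case False
    hence l: "length xs - k = Suc k" "k < length xs" by (auto simp: k_def elim: oddE)
    have "xs = take k xs @ xs ! k # drop (Suc k) xs" using l by (simp add: id_take_nth_drop[symmetric])
    \<comment> \<open>The middle entry is positive, so it is not mistaken for the marker 0 of even
      length.\<close>
    also have "\<dots> = palindrome_of (take k xs) (xs ! k)"
      using t l assms(2) by (simp add: palindrome_of_def)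
    finally show ?thesis by (rule that)
  qed
qed

text \<open>The two palindromes are coded by their centres and by the concatenation of their first
  halves, together with the place where to cut it. Each half counts twice in the sum, so the halves
  together sum to at most \<open>n/2\<close>.\<close>

lemma card_compositions_reflection:
  "card {xs \<in> compositions n. \<exists>d. d < length xs \<and> rotate d xs = rev xs} \<le> negligible_bound n"
proof (rule card_le_negligible_bound[where g = "\<lambda>i b c _ h. palindrome_of (take i h) b @ palindrome_of (drop i h) c"])
  fix xs assume "xs \<in> {xs \<in> compositions n. \<exists>d. d < length xs \<and> rotate d xs = rev xs}"
  then obtain d where xs: "xs \<in> compositions n" and d: "d < length xs" "rotate d xs = rev xs"
    by auto
  \<comment> \<open>The left side is \<open>rotate d xs\<close>, the right side
    \<open>rev xs\<close>. Corresponding blocks have equal lengths, so each block equals its own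
    reversal.\<close>
  have "drop d xs @ take d xs = rev (drop d xs) @ rev (take d xs)"
    using d by (simp add: rotate_drop_take flip: rev_append)
  hence pal: "rev (drop d xs) = drop d xs" "rev (take d xs) = take d xs"
    by (auto simp: append_eq_append_conv)
  have pos: "\<forall>x\<in>set xs. 0 < x" "sum_list xs = n" using xs by (auto simp: compositions_def)
  obtain h b where h: "take d xs = palindrome_of h b"
    by (rule palindrome_conv_palindrome_of[OF pal(2)]) (use pos in \<open>auto dest: in_set_takeD\<close>)
  obtain h' c where h': "drop d xs = palindrome_of h' c"
    by (rule palindrome_conv_palindrome_of[OF pal(1)]) (use pos in \<open>auto dest: in_set_dropD\<close>)
  have eq: "xs = palindrome_of h b @ palindrome_of h' c" using h h' by (metis append_take_drop_id)
  have sum: "sum_list (palindrome_of h b) = 2 * sum_list h + b" for h b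
    by (simp add: palindrome_of_def sum_list_rev)
  have "2 * sum_list h + b + (2 * sum_list h' + c) = n" using pos(2) eq sum by simp
  moreover have "set (h @ h') \<subseteq> set xs" unfolding eq palindrome_of_def by auto
  hence "\<forall>x\<in>set (h @ h'). 0 < x" using pos(1) by blast
  moreover from this have "length h \<le> sum_list h" by (intro length_le_sum_list) auto
  ultimately show "\<exists>a\<le>n. \<exists>b\<le>n. \<exists>c\<le>n. \<exists>d\<le>n. \<exists>h\<in>compositions_upto (n div 2).
      xs = palindrome_of (take a h) b @ palindrome_of (drop a h) c"
    using eq by (intro exI[of _ "length h"] exI[of _ b] exI[of _ c] exI[of _ 0] conjI bexI[of _ "h @ h'"])
                (auto simp: compositions_upto_def)
qed

section \<open>From polygons to compositions, and the asymptotics\<close>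

definition polygon_compositions :: "nat \<Rightarrow> nat list set" where
  "polygon_compositions n =
     {xs. 3 \<le> length xs \<and> sum_list xs = n \<and> (\<forall>x\<in>set xs. 0 < x \<and> real x < n / 2)}"

text \<open>Equivalent polygons are those whose side lists have the same class. Hence the quotient
  is counted by the classes of side lists, and the injectivity of \<open>map real\<close> allows
  counting them over the natural numbers.\<close>

lemma num_integer_polygons_eq:
  "num_integer_polygons n = card (dihedral_class ` polygon_compositions n)"
proof -
  let ?A = "integer_polygons n"
  have "polygon_equivalent P Q \<longleftrightarrow>
      dihedral_class (side_lengths P) = dihedral_class (side_lengths Q)" for P Q
  proof -
    have "length P = length Q" if "side_lengths Q \<in> dihedral_class (side_lengths P)"
      using dihedral_class_invariants(1)[OF that] by (simp add: side_lengths_def)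
    thus ?thesis
      unfolding polygon_equivalent_def dihedral_class_eq_iff dihedral_class_iff by blast
  qed
  hence "num_integer_polygons n = card ((\<lambda>P. dihedral_class (side_lengths P)) ` ?A)"
    by (simp add: num_integer_polygons_def card_quotient_kernel)
  also have "(\<lambda>P. dihedral_class (side_lengths P)) ` ?A = dihedral_class ` side_lengths ` ?A"
    by (simp add: image_image)
  also have "\<dots> = (\<lambda>c. map real ` c) ` dihedral_class ` polygon_compositions n"
    by (simp add: integer_polygon_side_lengths polygon_compositions_def image_image dihedral_class_map)
  also have "card \<dots> = card (dihedral_class ` polygon_compositions n)"
    by (intro card_image inj_on_subset[OF inj_on_image] subset_UNIV)
       (auto simp: inj_on_def inj_map_eq_map)
  finally show ?thesis .
qed

text \<open>One or two parts always include one of size at least \<open>n/2\<close>, so bounding the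
  parts already forces three sides.\<close>

lemma polygon_compositions_eq:
  assumes "n \<ge> 1"
  shows "polygon_compositions n = compositions n - {xs \<in> compositions n. \<exists>x\<in>set xs. n \<le> 2 * x}"
proof -
  have "3 \<le> length xs" if "sum_list xs = n" "\<forall>x\<in>set xs. 2 * x < n" for xs
  proof (rule ccontr)
    assume "\<not> 3 \<le> length xs"
    then consider "xs = []" | x where "xs = [x]" | x y where "xs = [x, y]"
      by (cases xs rule: list.exhaust; cases "tl xs"; cases "tl (tl xs)") auto
    thus False using that assms by cases auto
  qed
  moreover have half: "real x < n / 2 \<longleftrightarrow> 2 * x < n" for x by linarith
  ultimately show ?thesis
    unfolding polygon_compositions_def compositions_def half not_le[symmetric] by blast
qed

text \<open>The count is at least the sum of \<open>w\<close> over all compositions minus that over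
  \<open>B\<close>, which costs one \<open>negligible_bound\<close>. It exceeds the sum by at most
  the number of symmetric lists, rotational or reflectional, which costs two.\<close>

lemma num_integer_polygons_bounds:
  assumes "n \<ge> 1"
  shows "\<bar>real (num_integer_polygons n) - (2 ^ n - 1) / (2 * real n)\<bar> \<le> 2 * real (negligible_bound n)"
proof -
  define X where "X = polygon_compositions n"
  define B where "B = {xs \<in> compositions n. \<exists>x\<in>set xs. n \<le> 2 * x}"
  define w where "w = (\<lambda>xs :: nat list. 1 / (2 * real (length xs)))"
  define S where "S = {xs \<in> X. card (dihedral_class xs) \<noteq> 2 * length xs}"
  have X: "X = compositions n - B" using polygon_compositions_eq[OF assms] by (simp add: X_def B_def)
  have finX: "finite X" using X finite_compositions by simp
  have nonempty: "xs \<noteq> []" if "xs \<in> X" for xs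
    using that by (auto simp: X_def polygon_compositions_def)
  have "dihedral_class xs \<subseteq> X" if "xs \<in> X" for xs
  proof
    fix ys assume "ys \<in> dihedral_class xs"
    from dihedral_class_invariants[OF this] that show "ys \<in> X"
      by (simp add: X_def polygon_compositions_def) (metis sum_mset_sum_list)
  qed
  hence p: "real (num_integer_polygons n) = (\<Sum>xs\<in>X. 1 / real (card (dihedral_class xs)))"
    unfolding num_integer_polygons_eq X_def[symmetric] by (rule card_dihedral_classes[OF finX])
  have total: "(\<Sum>xs\<in>X. w xs) + (\<Sum>xs\<in>B. w xs) = (2 ^ n - 1) / (2 * real n)"
    unfolding sum_inverse_length_compositions[OF assms, symmetric] w_def[symmetric] X
    using finite_compositions by (subst sum.subset_diff[of B "compositions n"]) (auto simp: B_def)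
  \<comment> \<open>For the empty list, division by zero gives \<open>w [] = 0\<close>.\<close>
  have w1: "w xs \<le> 1" "0 \<le> w xs" for xs
    by (cases xs; simp add: w_def field_simps)+
  have "(\<Sum>xs\<in>B. w xs) \<le> (\<Sum>xs\<in>B. 1)" by (intro sum_mono w1)
  hence B: "0 \<le> (\<Sum>xs\<in>B. w xs)" "(\<Sum>xs\<in>B. w xs) \<le> real (negligible_bound n)"
    using card_compositions_big_part[of n] by (auto simp: B_def intro: sum_nonneg w1)
  have lower: "(\<Sum>xs\<in>X. w xs) \<le> real (num_integer_polygons n)"
    unfolding p
  proof (rule sum_mono)
    fix xs assume xs: "xs \<in> X"
    hence "real (card (dihedral_class xs)) \<le> 2 * real (length xs)"
      using card_dihedral_class_le[OF nonempty, of xs] by linarith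
    thus "w xs \<le> 1 / real (card (dihedral_class xs))"
      using card_dihedral_class_pos[of xs] nonempty[OF xs] unfolding w_def
      by (intro divide_left_mono) auto
  qed
  \<comment> \<open>Outside \<open>S\<close> the orbit is full and the term is exactly
    \<open>w xs\<close>; on \<open>S\<close> the crude bound 1 suffices.\<close>
  have "real (num_integer_polygons n) \<le> (\<Sum>xs\<in>X. w xs + (if xs \<in> S then 1 else 0))"
    unfolding p
  proof (rule sum_mono)
    fix xs assume xs: "xs \<in> X"
    show "1 / real (card (dihedral_class xs)) \<le> w xs + (if xs \<in> S then 1 else 0)"
    proof (cases "xs \<in> S")
      case True
      have "1 / real (card (dihedral_class xs)) \<le> 1"
        using card_dihedral_class_pos[of xs] by simp
      thus ?thesis using True w1(2)[of xs] by simp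
    qed (use xs in \<open>auto simp: S_def w_def\<close>)
  qed
  also have "\<dots> = (\<Sum>xs\<in>X. w xs) + real (card S)"
    using finX by (simp add: sum.distrib sum.If_cases S_def Int_def)
  finally have upper: "real (num_integer_polygons n) \<le> (\<Sum>xs\<in>X. w xs) + real (card S)" .
  let ?S1 = "{xs \<in> compositions n. \<exists>d. 0 < d \<and> d < length xs \<and> rotate d xs = xs}"
  let ?S2 = "{xs \<in> compositions n. \<exists>d. d < length xs \<and> rotate d xs = rev xs}"
  have "S \<subseteq> ?S1 \<union> ?S2"
  proof
    fix xs assume "xs \<in> S"
    hence xs: "xs \<in> compositions n" "xs \<noteq> []" "card (dihedral_class xs) \<noteq> 2 * length xs"
      using nonempty by (auto simp: S_def X)
    from xs(2,3) show "xs \<in> ?S1 \<union> ?S2"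
      by (cases rule: card_dihedral_class_less_cases) (use xs(1) in auto)
  qed
  hence "card S \<le> card (?S1 \<union> ?S2)" by (intro card_mono) (use finite_compositions in auto)
  also have "\<dots> \<le> card ?S1 + card ?S2" by (rule card_Un_le)
  also have "\<dots> \<le> 2 * negligible_bound n"
    using card_compositions_rotation[of n] card_compositions_reflection[of n] by simp
  finally have "real (card S) \<le> 2 * real (negligible_bound n)" by linarith
  thus ?thesis using lower upper total B by linarith
qed

theorem theorem1p7:
  shows "(\<lambda>n. real (num_integer_polygons n)) \<sim>[at_top] (\<lambda>n. 2 ^ (n - 1) / real n)"
proof (rule asymp_equivI')
  define p where "p = (\<lambda>n. real (num_integer_polygons n))"
  \<comment> \<open>This bounds the relative error. Replacing \<open>n div 2\<close> by
    \<open>n / 2\<close> gives a closed form of size polynomial times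
    \<open>2 powr (- n / 2)\<close>.\<close>
  define e where
    "e = (\<lambda>n. (1 + 4 * real n * ((real n + 1) ^ 4 * 2 powr (real n / 2))) / 2 powr real n)"
  have e0: "e \<longlonglongrightarrow> 0" unfolding e_def by real_asymp
  have "norm (p n / (2 ^ (n - 1) / real n) - 1) \<le> e n" if n: "n \<ge> 1" for n
  proof -
    have pw: "(2 :: real) ^ n = 2 * 2 ^ (n - 1)" using n by (cases n) auto
    \<comment> \<open>The final \<open>- 1\<close> cancels the one in \<open>2 ^ n - 1\<close>,
      leaving the error of \<open>num_integer_polygons_bounds\<close> scaled by
      \<open>2 * n / 2 ^ n\<close>.\<close>
    have "p n / (2 ^ (n - 1) / real n) - 1 =
        (2 * real n * (p n - (2 ^ n - 1) / (2 * real n)) - 1) / 2 ^ n"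
      using n by (simp add: pw field_simps)
    hence "norm (p n / (2 ^ (n - 1) / real n) - 1) =
        \<bar>2 * real n * (p n - (2 ^ n - 1) / (2 * real n)) - 1\<bar> / 2 ^ n" by simp
    also have "\<dots> \<le> (1 + 4 * real n * real (negligible_bound n)) / 2 ^ n"
    proof (rule divide_right_mono)
      have "\<bar>2 * real n * (p n - (2 ^ n - 1) / (2 * real n))\<bar> \<le>
          2 * real n * (2 * real (negligible_bound n))"
        unfolding abs_mult using num_integer_polygons_bounds[OF n]
        by (intro mult_mono) (auto simp: p_def)
      thus "\<bar>2 * real n * (p n - (2 ^ n - 1) / (2 * real n)) - 1\<bar> \<le>
          1 + 4 * real n * real (negligible_bound n)" by linarith
    qed simp
    also have "\<dots> \<le> e n"
    proof -
      have "(2 :: real) ^ (n div 2) = 2 powr real (n div 2)" by (simp add: powr_realpow)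
      also have "\<dots> \<le> 2 powr (real n / 2)" by (intro powr_mono) linarith+
      finally have "real (negligible_bound n) \<le> (real n + 1) ^ 4 * 2 powr (real n / 2)"
        by (simp add: negligible_bound_def add.commute)
      thus ?thesis unfolding e_def
        by (simp add: powr_realpow divide_right_mono mult_left_mono)
    qed
    finally show ?thesis .
  qed
  hence "eventually (\<lambda>n. norm (p n / (2 ^ (n - 1) / real n) - 1) \<le> e n) at_top"
    by (rule eventually_mono[OF eventually_ge_at_top[of 1]])
  hence "(\<lambda>n. p n / (2 ^ (n - 1) / real n) - 1) \<longlonglongrightarrow> 0"
    using e0 by (rule Lim_null_comparison)
  thus "(\<lambda>n. real (num_integer_polygons n) / (2 ^ (n - 1) / real n)) \<longlonglongrightarrow> 1"
    unfolding p_def by (rule LIM_zero_cancel)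
qed

end
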